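(* Let $E\subset\mathbb{R}^2$ be the standard Sierpiński triangle of side length $1$. Then its Feng--Wu thickness is $$\tau(E)=\frac{\sqrt{3}}{6}.$$ More concretely, for every $x\in E$ and every $r$ with $0<r\le 1$, the convex hull $\operatorname{conv}(E\cap B(x,r))$ contains an equilateral triangle of side length $r$, and hence contains a closed disk of radius $\frac{\sqrt{3}}{6}r$; and moreover the constant $\frac{\sqrt{3}}{6}$ is optimal, i.e. for every real $c>\frac{\sqrt{3}}{6}$ there exist $x\in E$ and $0<r\le 1$ such that $\operatorname{conv}(E\cap B(x,r))$ contains no closed disk of radius $cr$.
   Context: Let $v_1=(0,0)$, $v_2=(1,0)$, $v_3=\bigl(\frac12,\frac{\sqrt3}{2}\bigr)$ in $\mathbb{R}^2$. For $i=1,2,3$ define $\phi_i:\mathbb{R}^2\to\mathbb{R}^2$ by $\phi_i(x)=\frac{x+v_i}{2}$. The standard Sierpiński triangle $E$ (of side length $1$) is the unique nonempty compact set $E\subset\mathbb{R}^2$ satisfying $E=\phi_1(E)\cup\phi_2(E)\cup\phi_3(E)$. $B(x,r)$ denotes the closed Euclidean disk of radius $r$ centered at $x$, and $\operatorname{conv}$ denotes convex hull. An equilateral triangle is understood as the (filled) convex hull of its three vertices. For a compact set $F\subset\mathbb{R}^2$, the (Feng--Wu) thickness of $F$ is $$\tau(F)=\sup\bigl\{c\in[0,1]:\ \forall x\in F,\ \forall\, 0<r\le \operatorname{diam}(F),\ \exists y\in\mathbb{R}^2 \text{ with } B(y,cr)\subset\operatorname{conv}(F\cap B(x,r))\bigr\},$$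 where $\operatorname{diam}(F)$ is the diameter of $F$. *)

theory Defs
  imports "HOL-Analysis.Analysis"
begin

definition v1 :: "real ^ 2" where "v1 = vector [0, 0]"
definition v2 :: "real ^ 2" where "v2 = vector [1, 0]"
definition v3 :: "real ^ 2" where "v3 = vector [1 / 2, sqrt 3 / 2]"

definition half_map :: "real ^ 2 \<Rightarrow> real ^ 2 \<Rightarrow> real ^ 2" where
  "half_map v x = (1 / 2) *\<^sub>R (x + v)"

text \<open>
  The three maps are contractions, so by Hutchinson's theorem exactly one set
  satisfies this description; the definition itself does not establish that.
\<close>

definition sierpinski :: "(real ^ 2) set" where
  "sierpinski = (THE E. E \<noteq> {} \<and> compact E \<and>
     E = half_map v1 ` E \<union> half_map v2 ` E \<union> half_map v3 ` E)"

definition equilateral_triangle :: "real \<Rightarrow> (real ^ 2) set \<Rightarrow> bool" where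
  "equilateral_triangle s T \<longleftrightarrow>
     (\<exists>a b c. dist a b = s \<and> dist b c = s \<and> dist c a = s \<and> T = convex hull {a, b, c})"

text \<open>
  The thickness is meant for compact \<open>F\<close>. For nonempty \<open>F\<close> the set below
  contains \<open>0\<close> and is bounded above by \<open>1\<close>, so the real supremum is the true one.
\<close>

definition thickness :: "(real ^ 2) set \<Rightarrow> real" where
  "thickness F = Sup {c \<in> {0..1}. \<forall>x\<in>F. \<forall>r. 0 < r \<and> r \<le> diameter F \<longrightarrow>
     (\<exists>y. cball y (c * r) \<subseteq> convex hull (F \<inter> cball x r))}"

end

theory Submission
  imports Defs
begin

text \<open>
  Write \<open>V\<close> for the set of corners of the big triangle. The triangle of side \<open>r\<close> in the hull can
  always be chosen with corners \<open>c + r V\<close>, all three of which are themselves points of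
  \<open>E \<inter> B(x, r)\<close> (\<open>ex_scaled_copy_in_attractor\<close>). Suppose first that \<open>1/2 \<le> r \<le> 1\<close>. The point \<open>x\<close> lies in
  some half-size piece \<open>\<phi>\<^sub>v(E)\<close>; enlarge the triangle around that piece from its corner \<open>v\<close> to
  side \<open>r\<close>. The result has its corners on two sides of the big triangle, which belong to \<open>E\<close>,
  and it contains \<open>x\<close>; as its diameter is \<open>r\<close>, its corners are within \<open>r\<close> of \<open>x\<close>. Smaller radii
  follow by self-similarity: applying \<open>\<phi>\<^sub>u\<close> to a copy found at scale \<open>2r\<close> gives one at scale \<open>r\<close>.

  The triangle of side \<open>r\<close> contains its incircle, of radius \<open>\<surd>3/6 r\<close>
  (\<open>incircle_in_triangle\<close>). Conversely \<open>E\<close> lies in the big triangle, so at \<open>r = 1\<close> no disk can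
  exceed the inradius of that triangle: adding the three inequalities that keep the disk on the
  inner side of each edge eliminates the centre (\<open>disk_in_triangle_radius_le\<close>). As \<open>E\<close> has
  diameter 1, the radius 1 is among those that the thickness quantifies over.

  Since \<open>E\<close> is given by a definite description, existence and uniqueness of the invariant compact
  set are part of the proof. Existence comes from a greatest fixed point, and
  uniqueness from halving the largest distance between two candidates.
\<close>

section \<open>The attractor of the half-way maps towards a set of points\<close>

text \<open>
  Taking the greatest fixed point makes coinduction available: a subset of the hull lies in the
  attractor as soon as it is covered by its own half-size copies. Intersecting with the hull is
  essential: without it, the greatest fixed point for a nonempty \<open>V\<close> would be the whole plane.
\<close>

definition attractor :: "(real ^ 2) set \<Rightarrow> (real ^ 2) set" where
  "attractor V = gfp (\<lambda>A. convex hull V \<inter> (\<Union>v\<in>V. half_map v ` A))"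

lemma dist_half_map [simp]: "dist (half_map v x) (half_map v y) = dist x y / 2"
  by (simp add: half_map_def dist_norm flip: scaleR_diff_right)

lemma compact_half_map_image: "compact A \<Longrightarrow> compact (half_map v ` A)"
  unfolding half_map_def by (intro compact_continuous_image continuous_intros)

lemma half_map_in_convex_hull:
  assumes "v \<in> V" "x \<in> convex hull V"
  shows "half_map v x \<in> convex hull V"
proof -
  have "(1 / 2) *\<^sub>R x + (1 / 2) *\<^sub>R v \<in> convex hull V"
    using assms by (intro convexD convex_convex_hull) (auto intro: hull_inc)
  then show ?thesis by (simp add: half_map_def scaleR_add_right)
qed

lemma mono_attractor_step:
  "mono (\<lambda>A. convex hull V \<inter> (\<Union>v\<in>V. half_map v ` A))"
  by (rule monoI) blast

lemma attractor_coinduct: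
  assumes "A \<subseteq> convex hull V" "A \<subseteq> (\<Union>v\<in>V. half_map v ` A)"
  shows "A \<subseteq> attractor V"
  unfolding attractor_def using assms by (intro gfp_upperbound) blast

lemma attractor_subset_hull: "attractor V \<subseteq> convex hull V"
  unfolding attractor_def by (subst gfp_unfold[OF mono_attractor_step]) blast

lemma attractor_eq: "attractor V = (\<Union>v\<in>V. half_map v ` attractor V)"
proof -
  have "attractor V = convex hull V \<inter> (\<Union>v\<in>V. half_map v ` attractor V)"
    unfolding attractor_def by (rule gfp_unfold[OF mono_attractor_step])
  moreover have "(\<Union>v\<in>V. half_map v ` attractor V) \<subseteq> convex hull V"
    using attractor_subset_hull half_map_in_convex_hull by blast
  ultimately show ?thesis by blast
qed

text \<open>
  The closure of the attractor still satisfies the hypotheses of coinduction, because a finite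
  union of images of a compact set is closed; hence the attractor is its own closure.
\<close>

lemma compact_attractor:
  assumes "finite V"
  shows "compact (attractor V)"
proof -
  let ?C = "closure (attractor V)"
  have hull: "compact (convex hull V)"
    using assms by (simp add: finite_imp_compact_convex_hull)
  have C_hull: "?C \<subseteq> convex hull V"
    by (simp add: attractor_subset_hull closure_minimal compact_imp_closed hull)
  then have C: "compact ?C"
    by (metis hull closed_closure compact_Int_closed inf.absorb_iff2)
  have "closed (\<Union>v\<in>V. half_map v ` ?C)"
    using assms C by (intro compact_imp_closed compact_UN compact_half_map_image) auto
  moreover have "attractor V \<subseteq> (\<Union>v\<in>V. half_map v ` ?C)"
    using attractor_eq[of V] closure_subset[of "attractor V"] by blast
  ultimately have "?C \<subseteq> (\<Union>v\<in>V. half_map v ` ?C)"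
    by (rule closure_minimal[rotated])
  then have "?C \<subseteq> attractor V"
    by (rule attractor_coinduct[OF C_hull])
  then show ?thesis
    using C closure_subset by (metis subset_antisym)
qed

text \<open>
  A segment between two points of \<open>V\<close> is the union of its two halves, each of which is a half-size
  copy of it, so coinduction applies.
\<close>

lemma segment_subset_attractor:
  assumes "v \<in> V" "w \<in> V"
  shows "closed_segment v w \<subseteq> attractor V"
proof (rule attractor_coinduct)
  show "closed_segment v w \<subseteq> convex hull V"
    using assms by (simp add: closed_segment_subset hull_inc)
  show "closed_segment v w \<subseteq> (\<Union>u\<in>V. half_map u ` closed_segment v w)"
  proof
    fix x assume "x \<in> closed_segment v w"
    then obtain t where t: "0 \<le> t" "t \<le> 1" and x: "x = (1 - t) *\<^sub>R v + t *\<^sub>R w"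
      by (auto simp: in_segment)
    show "x \<in> (\<Union>u\<in>V. half_map u ` closed_segment v w)"
    proof (cases "t \<le> 1 / 2")
      case True
      have "x = half_map v ((1 - 2 * t) *\<^sub>R v + (2 * t) *\<^sub>R w)"
        by (simp add: x half_map_def vec_eq_iff field_simps)
      moreover have "(1 - 2 * t) *\<^sub>R v + (2 * t) *\<^sub>R w \<in> closed_segment v w"
        using t True by (auto simp: in_segment intro!: exI[of _ "2 * t"])
      ultimately show ?thesis using assms by blast
    next
      case False
      have "x = half_map w ((1 - (2 * t - 1)) *\<^sub>R v + (2 * t - 1) *\<^sub>R w)"
        by (simp add: x half_map_def vec_eq_iff field_simps)
      moreover have "(1 - (2 * t - 1)) *\<^sub>R v + (2 * t - 1) *\<^sub>R w \<in> closed_segment v w"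
        using t False by (auto simp: in_segment intro!: exI[of _ "2 * t - 1"])
      ultimately show ?thesis using assms by blast
    qed
  qed
qed

text \<open>
  This gives uniqueness of the invariant set. A point \<open>m\<close> of \<open>A\<close> farthest from \<open>B\<close> is the image of
  some \<open>a\<close> in \<open>A\<close>. The map that sends \<open>a\<close> to \<open>m\<close> halves distances and preserves \<open>B\<close>, so \<open>m\<close> is at
  most half as far from \<open>B\<close> as \<open>a\<close>, and hence at most half as far as \<open>m\<close>: the largest distance
  vanishes.
\<close>

lemma compact_half_map_invariant_subset:
  assumes A: "compact A" "A \<subseteq> (\<Union>v\<in>V. half_map v ` A)"
    and B: "closed B" "B \<noteq> {}" "(\<Union>v\<in>V. half_map v ` B) \<subseteq> B"
  shows "A \<subseteq> B"
proof (cases "A = {}")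
  case False
  have "continuous_on A (\<lambda>x. infdist x B)"
    by (intro continuous_intros)
  then obtain m where m: "m \<in> A" and max: "\<And>x. x \<in> A \<Longrightarrow> infdist x B \<le> infdist m B"
    using continuous_attains_sup[OF A(1) False] by blast
  obtain v a where v: "v \<in> V" and a: "a \<in> A" and m_eq: "m = half_map v a"
    using m A(2) by blast
  obtain b where b: "b \<in> B" and dist_b: "infdist a B = dist a b"
    using infdist_attains_inf[OF B(1,2)] by blast
  have "half_map v b \<in> B"
    using B(3) v b by blast
  then have "infdist m B \<le> infdist a B / 2"
    using infdist_le[of "half_map v b" B m] by (simp add: m_eq dist_b)
  then have "infdist m B \<le> 0"
    using max[OF a] by simp
  show ?thesis
  proof
    fix x assume "x \<in> A"
    then have "infdist x B = 0"
      using max \<open>infdist m B \<le> 0\<close> infdist_nonneg[of x B] by (meson order_antisym order_trans)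
    then show "x \<in> B"
      using B in_closed_iff_infdist_zero by blast
  qed
qed auto

section \<open>Scaled copies of the generating points near each point of the attractor\<close>

text \<open>
  The copies used have the form \<open>c + r V\<close> for a translation vector \<open>c\<close>, so that every shape
  inscribed in the hull of \<open>V\<close> can be carried along. The induction on \<open>n\<close> is on the scale, starting
  from radii of at least \<open>1/2\<close>.
\<close>

lemma ex_scaled_copy_in_attractor:
  assumes close: "\<And>v w. v \<in> V \<Longrightarrow> w \<in> V \<Longrightarrow> dist v w \<le> 1"
    and "x \<in> attractor V" "0 < r" "r \<le> 1"
  obtains c where "(\<lambda>v. c + r *\<^sub>R v) ` V \<subseteq> attractor V \<inter> cball x r"
proof -
  have copy: "\<exists>c. (\<lambda>v. c + r *\<^sub>R v) ` V \<subseteq> attractor V \<inter> cball x r"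
    if "x \<in> attractor V" "(1 / 2) ^ Suc n \<le> r" "r \<le> 1" for n x and r :: real
    using that
  proof (induction n arbitrary: x r)
    case 0
    then have r: "1 / 2 \<le> r" "r \<le> 1" by auto
    obtain v y where v: "v \<in> V" and y: "y \<in> attractor V" and x: "x = half_map v y"
      using 0(1) attractor_eq[of V] by blast
    \<comment> \<open>The homothety with centre \<open>v\<close> and ratio \<open>r\<close> sends \<open>z\<close> to \<open>x\<close>. The point \<open>z\<close> stays in the hull
      because \<open>1 / (2 * r) \<le> 1\<close>; this is where \<open>r \<ge> 1 / 2\<close> is needed.\<close>
    define z where "z = (1 - 1 / (2 * r)) *\<^sub>R v + (1 / (2 * r)) *\<^sub>R y"
    have z: "z \<in> convex hull V"
      unfolding z_def using r v y attractor_subset_hull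
      by (intro convexD convex_convex_hull) (auto intro: hull_inc simp: field_simps)
    have x_z: "x = (1 - r) *\<^sub>R v + r *\<^sub>R z"
      using r by (simp add: x z_def half_map_def vec_eq_iff field_simps)
    have "(1 - r) *\<^sub>R v + r *\<^sub>R w \<in> attractor V \<inter> cball x r" if w: "w \<in> V" for w
    proof
      show "(1 - r) *\<^sub>R v + r *\<^sub>R w \<in> attractor V"
        using segment_subset_attractor[OF v w] r by (force simp: in_segment)
      have "convex hull V \<subseteq> cball w 1"
        using close[OF w] by (intro hull_minimal) auto
      then have "dist w z \<le> 1" using z by auto
      then show "(1 - r) *\<^sub>R v + r *\<^sub>R w \<in> cball x r"
        using r by (simp add: x_z dist_norm norm_minus_commute flip: scaleR_diff_right)
    qed
    then show ?case by blast
  next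
    case (Suc n)
    show ?case
    proof (cases "(1 / 2) ^ Suc n \<le> r")
      case True
      then show ?thesis using Suc by blast
    next
      case False
      then have "2 * r \<le> 1"
        using power_le_one[of "1 / 2 :: real" n] by simp
      obtain u y where u: "u \<in> V" and y: "y \<in> attractor V" and x: "x = half_map u y"
        using Suc.prems(1) attractor_eq[of V] by blast
      obtain c where c: "(\<lambda>v. c + (2 * r) *\<^sub>R v) ` V \<subseteq> attractor V \<inter> cball y (2 * r)"
        using Suc.IH[OF y, of "2 * r"] Suc.prems \<open>2 * r \<le> 1\<close> by auto
      have "half_map u c + r *\<^sub>R w \<in> attractor V \<inter> cball x r" if "w \<in> V" for w
      proof -
        have eq: "half_map u c + r *\<^sub>R w = half_map u (c + (2 * r) *\<^sub>R w)"
          by (simp add: half_map_def vec_eq_iff field_simps)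
        have *: "c + (2 * r) *\<^sub>R w \<in> attractor V" "dist y (c + (2 * r) *\<^sub>R w) \<le> 2 * r"
          using c that by auto
        show ?thesis
          unfolding eq x using * u attractor_eq[of V] by auto
      qed
      then show ?thesis by blast
    qed
  qed
  obtain n where "(1 / 2) ^ n < r"
    using real_arch_pow_inv[of r "1 / 2"] \<open>0 < r\<close> by auto
  then have "(1 / 2) ^ Suc n \<le> r"
    using \<open>0 < r\<close> by simp
  then show ?thesis
    using copy assms that by blast
qed

section \<open>The big triangle and its inscribed circle\<close>

abbreviation corners :: "(real ^ 2) set" where
  "corners \<equiv> {v1, v2, v3}"

lemmas corner_coords = v1_def v2_def v3_def

lemma norm_real2: "norm (x :: real ^ 2) = sqrt ((x $ 1)\<^sup>2 + (x $ 2)\<^sup>2)"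
  by (simp add: norm_vec_def L2_set_def sum_2)

lemma dist_corners: "dist v1 v2 = 1" "dist v2 v3 = 1" "dist v3 v1 = 1"
  by (simp_all add: dist_norm norm_real2 corner_coords power_divide)

lemma dist_corners_le:
  assumes "v \<in> corners" "w \<in> corners"
  shows "dist v w \<le> 1"
  using assms dist_corners by (auto simp: dist_commute)

lemma inner_real2: "inner x (y :: real ^ 2) = x $ 1 * y $ 1 + x $ 2 * y $ 2"
  by (simp add: inner_vec_def sum_2)

lemma triangle_halfplanes:
  "convex hull corners =
    {x. 0 \<le> x $ 2 \<and> x $ 2 \<le> sqrt 3 * x $ 1 \<and> x $ 2 \<le> sqrt 3 * (1 - x $ 1)}"
  (is "_ = ?H")
proof
  have "?H = {x. inner (vector [0, -1]) x \<le> 0} \<inter> {x. inner (vector [- sqrt 3, 1]) x \<le> 0}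
      \<inter> {x. inner (vector [sqrt 3, 1]) x \<le> sqrt 3}"
    by (auto simp: inner_real2 algebra_simps)
  then have "convex ?H"
    by (simp add: convex_Int convex_halfspace_le)
  then show "convex hull corners \<subseteq> ?H"
    by (intro hull_minimal) (auto simp: corner_coords field_simps)
  show "?H \<subseteq> convex hull corners"
  proof
    fix x assume x: "x \<in> ?H"
    \<comment> \<open>The barycentric coordinates of \<open>x\<close>: the slacks in the three inequalities, normalised to
      sum 1.\<close>
    define u where "u = (sqrt 3 * (1 - x $ 1) - x $ 2) / sqrt 3"
    define p where "p = (sqrt 3 * x $ 1 - x $ 2) / sqrt 3"
    define q where "q = 2 * x $ 2 / sqrt 3"
    have "0 \<le> u" "0 \<le> p" "0 \<le> q"
      using x by (auto simp: u_def p_def q_def)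
    moreover have "u + p + q = 1"
      by (simp add: u_def p_def q_def field_simps)
    moreover have "x = u *\<^sub>R v1 + p *\<^sub>R v2 + q *\<^sub>R v3"
      by (simp add: vec_eq_iff forall_2 corner_coords p_def q_def field_simps)
    ultimately show "x \<in> convex hull corners"
      unfolding convex_hull_3 by blast
  qed
qed

text \<open>
  The outward unit normals of the bottom, left and right sides. They sum to zero, which is why adding
  the inequalities for the three sides bounds the radius of a disk wherever its centre is.
\<close>

lemma unit_normals:
  "norm (vector [0, -1] :: real ^ 2) = 1"
  "norm (vector [- sqrt 3 / 2, 1 / 2] :: real ^ 2) = 1"
  "norm (vector [sqrt 3 / 2, 1 / 2] :: real ^ 2) = 1"
  by (simp_all add: norm_real2 power_divide)

lemma incircle_in_triangle:
  "cball (vector [1 / 2, sqrt 3 / 6]) (sqrt 3 / 6) \<subseteq> convex hull corners"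
proof
  fix x :: "real ^ 2"
  define d where "d = x - vector [1 / 2, sqrt 3 / 6]"
  assume "x \<in> cball (vector [1 / 2, sqrt 3 / 6]) (sqrt 3 / 6)"
  then have "norm d \<le> sqrt 3 / 6"
    by (simp add: d_def dist_norm norm_minus_commute)
  then have bound: "inner n d \<le> sqrt 3 / 6" if "norm n = 1" for n
    using norm_cauchy_schwarz[of n d] that by simp
  have coords: "x $ 1 = 1 / 2 + d $ 1" "x $ 2 = sqrt 3 / 6 + d $ 2"
    by (simp_all add: d_def)
  show "x \<in> convex hull corners"
    using unit_normals[THEN bound]
    by (simp add: triangle_halfplanes coords inner_real2 algebra_simps)
qed

lemma disk_in_triangle_radius_le:
  assumes "cball y c \<subseteq> convex hull corners" "0 \<le> c"
  shows "c \<le> sqrt 3 / 6"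
proof -
  \<comment> \<open>The points where the disk reaches farthest towards each side suffice.\<close>
  have mem: "y + c *\<^sub>R d \<in> convex hull corners" if "norm d = 1" for d
    using assms that by (auto simp: dist_norm intro!: subsetD[OF assms(1)])
  note unit_normals[THEN mem, unfolded triangle_halfplanes]
  then show ?thesis
    by (simp add: algebra_simps)
qed

section \<open>Thickness of the Sierpinski triangle\<close>

lemma sierpinski_eq_attractor: "sierpinski = attractor corners"
  unfolding sierpinski_def
proof (rule the_equality)
  have nonempty: "attractor corners \<noteq> {}"
    using segment_subset_attractor[of v1 corners v1] by auto
  have compact: "compact (attractor corners)"
    by (simp add: compact_attractor)
  have inv: "(\<Union>v\<in>corners. half_map v ` attractor corners) = attractor corners"
    by (rule attractor_eq[symmetric])
  show "attractor corners \<noteq> {} \<and> compact (attractor corners) \<and> attractor corners =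
      half_map v1 ` attractor corners \<union> half_map v2 ` attractor corners
        \<union> half_map v3 ` attractor corners"
    using nonempty compact attractor_eq[of corners] by (simp add: Un_assoc)
  fix E assume E: "E \<noteq> {} \<and> compact E \<and>
    E = half_map v1 ` E \<union> half_map v2 ` E \<union> half_map v3 ` E"
  then have E_eq: "(\<Union>v\<in>corners. half_map v ` E) = E"
    by (simp add: Un_assoc)
  show "E = attractor corners"
  proof (rule subset_antisym)
    show "E \<subseteq> attractor corners"
      by (rule compact_half_map_invariant_subset
          [OF _ equalityD2[OF E_eq] compact_imp_closed[OF compact] nonempty equalityD1[OF inv]])
         (use E in blast)
    show "attractor corners \<subseteq> E"
      by (rule compact_half_map_invariant_subset
          [OF compact equalityD2[OF inv] _ _ equalityD1[OF E_eq]])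
         (use E compact_imp_closed in blast)+
  qed
qed

lemma corners_subset_sierpinski: "corners \<subseteq> sierpinski"
  unfolding sierpinski_eq_attractor
  using segment_subset_attractor[of _ corners] ends_in_segment(1) by blast

lemma diameter_sierpinski: "diameter sierpinski = 1"
proof (rule antisym)
  have "dist x y \<le> 1" if "x \<in> sierpinski" "y \<in> sierpinski" for x y
  proof -
    \<comment> \<open>A ball is convex, so distance bounds pass from the corners to the hull, once for each of the
      two points.\<close>
    have "convex hull corners \<subseteq> cball v 1" if "v \<in> corners" for v
      using dist_corners_le[OF that] by (intro hull_minimal) auto
    then have "corners \<subseteq> cball x 1"
      using \<open>x \<in> sierpinski\<close> attractor_subset_hull
      by (fastforce simp: sierpinski_eq_attractor dist_commute)
    then have "convex hull corners \<subseteq> cball x 1"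
      by (intro hull_minimal) auto
    then show ?thesis
      using \<open>y \<in> sierpinski\<close> attractor_subset_hull
      by (fastforce simp: sierpinski_eq_attractor)
  qed
  then show "diameter sierpinski \<le> 1"
    by (intro diameter_le) (auto simp: dist_norm)
  have "bounded sierpinski"
    by (simp add: sierpinski_eq_attractor compact_attractor compact_imp_bounded)
  then have "dist v1 v2 \<le> diameter sierpinski"
    using corners_subset_sierpinski by (intro diameter_bounded_bound) auto
  then show "1 \<le> diameter sierpinski"
    by (simp add: dist_corners)
qed

lemma ex_triangle_and_disk:
  assumes "x \<in> sierpinski" "0 < r" "r \<le> 1"
  shows "\<exists>T. equilateral_triangle r T \<and> T \<subseteq> convex hull (sierpinski \<inter> cball x r)"
    and "\<exists>y. cball y (sqrt 3 / 6 * r) \<subseteq> convex hull (sierpinski \<inter> cball x r)"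
proof -
  obtain c where c: "(\<lambda>v. c + r *\<^sub>R v) ` corners \<subseteq> sierpinski \<inter> cball x r"
    using ex_scaled_copy_in_attractor[OF dist_corners_le] assms
    unfolding sierpinski_eq_attractor by metis
  define T where "T = convex hull ((\<lambda>v. c + r *\<^sub>R v) ` corners)"
  have T: "T \<subseteq> convex hull (sierpinski \<inter> cball x r)"
    unfolding T_def by (rule hull_mono[OF c])
  have "dist (c + r *\<^sub>R v) (c + r *\<^sub>R w) = r * dist v w" for v w
    using assms(2) by (simp add: dist_norm flip: scaleR_diff_right)
  then have "equilateral_triangle r T"
    unfolding equilateral_triangle_def T_def
    by (intro exI[of _ "c + r *\<^sub>R v1"] exI[of _ "c + r *\<^sub>R v2"] exI[of _ "c + r *\<^sub>R v3"])
       (simp add: dist_corners)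
  with T show "\<exists>T. equilateral_triangle r T \<and> T \<subseteq> convex hull (sierpinski \<inter> cball x r)"
    by blast
  let ?g = "vector [1 / 2, sqrt 3 / 6] :: real ^ 2"
  have "cball (c + r *\<^sub>R ?g) (r * (sqrt 3 / 6)) = (\<lambda>z. c + r *\<^sub>R z) ` cball ?g (sqrt 3 / 6)"
  proof -
    have "cball (r *\<^sub>R ?g) (r * (sqrt 3 / 6)) = (\<lambda>z. r *\<^sub>R z) ` cball ?g (sqrt 3 / 6)"
      using assms(2) by (subst cball_scale) auto
    then show ?thesis
      by (simp only: cball_translation image_image)
  qed
  also have "\<dots> \<subseteq> T"
    unfolding T_def convex_hull_affinity by (rule image_mono[OF incircle_in_triangle])
  finally show "\<exists>y. cball y (sqrt 3 / 6 * r) \<subseteq> convex hull (sierpinski \<inter> cball x r)"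
    using T by (metis mult.commute subset_trans)
qed

lemma disk_in_hull_sierpinski_radius_le:
  assumes "cball y c \<subseteq> convex hull (sierpinski \<inter> B)" "0 \<le> c"
  shows "c \<le> sqrt 3 / 6"
proof (rule disk_in_triangle_radius_le)
  have "convex hull (sierpinski \<inter> B) \<subseteq> convex hull corners"
    using attractor_subset_hull[of corners]
    by (intro hull_minimal) (auto simp: sierpinski_eq_attractor)
  then show "cball y c \<subseteq> convex hull corners"
    using assms(1) by blast
qed (fact assms(2))

theorem theorem1:
  shows "thickness sierpinski = sqrt 3 / 6
    \<and> (\<forall>x\<in>sierpinski. \<forall>r. 0 < r \<and> r \<le> 1 \<longrightarrow>
         (\<exists>T. equilateral_triangle r T \<and> T \<subseteq> convex hull (sierpinski \<inter> cball x r)) \<and>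
         (\<exists>y. cball y (sqrt 3 / 6 * r) \<subseteq> convex hull (sierpinski \<inter> cball x r)))
    \<and> (\<forall>c > sqrt 3 / 6. \<exists>x\<in>sierpinski. \<exists>r. 0 < r \<and> r \<le> 1 \<and>
         \<not> (\<exists>y. cball y (c * r) \<subseteq> convex hull (sierpinski \<inter> cball x r)))"
proof (intro conjI)
  let ?S = "{c \<in> {0..1}. \<forall>x\<in>sierpinski. \<forall>r. 0 < r \<and> r \<le> diameter sierpinski \<longrightarrow>
     (\<exists>y. cball y (c * r) \<subseteq> convex hull (sierpinski \<inter> cball x r))}"
  have v1: "v1 \<in> sierpinski"
    using corners_subset_sierpinski by simp
  have "sqrt 3 \<le> 6"
    by (rule real_le_lsqrt) auto
  then have "sqrt 3 / 6 \<in> ?S"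
    using ex_triangle_and_disk(2) by (auto simp: diameter_sierpinski)
  moreover have "c \<le> sqrt 3 / 6" if "c \<in> ?S" for c
  proof -
    have "\<forall>r. 0 < r \<and> r \<le> 1 \<longrightarrow>
        (\<exists>y. cball y (c * r) \<subseteq> convex hull (sierpinski \<inter> cball v1 r))"
      using that v1 by (simp add: diameter_sierpinski)
    then obtain y where "cball y (c * 1) \<subseteq> convex hull (sierpinski \<inter> cball v1 1)"
      using zero_less_one by blast
    then show ?thesis
      using that disk_in_hull_sierpinski_radius_le[of y c] by simp
  qed
  ultimately show "thickness sierpinski = sqrt 3 / 6"
    unfolding thickness_def by (rule cSup_eq_maximum)
  show "\<forall>x\<in>sierpinski. \<forall>r. 0 < r \<and> r \<le> 1 \<longrightarrow>
      (\<exists>T. equilateral_triangle r T \<and> T \<subseteq> convex hull (sierpinski \<inter> cball x r)) \<and>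
      (\<exists>y. cball y (sqrt 3 / 6 * r) \<subseteq> convex hull (sierpinski \<inter> cball x r))"
    using ex_triangle_and_disk by blast
  show "\<forall>c > sqrt 3 / 6. \<exists>x\<in>sierpinski. \<exists>r. 0 < r \<and> r \<le> 1 \<and>
      \<not> (\<exists>y. cball y (c * r) \<subseteq> convex hull (sierpinski \<inter> cball x r))"
  proof (intro allI impI bexI[OF _ v1] exI[of _ 1] conjI notI)
    fix c :: real
    assume c: "sqrt 3 / 6 < c" and "\<exists>y. cball y (c * 1) \<subseteq> convex hull (sierpinski \<inter> cball v1 1)"
    then obtain y where "cball y c \<subseteq> convex hull (sierpinski \<inter> cball v1 1)"
      by auto
    moreover have "0 \<le> c"
      using c by (smt (verit) divide_nonneg_nonneg real_sqrt_ge_zero)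
    ultimately show False
      using c disk_in_hull_sierpinski_radius_le by force
  qed auto
qed

end
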